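(* Let $(X,\lambda)$ be a connected quasi-reversible graph. If there exists a solution to the Dirichlet problem on $\hat X$, then it is unique. That is, for every $f\colon\partial\hat X\to\mathbb{R}$ there is at most one $h\in H(\hat X)$ such that $h|_{\partial\hat X}=f$.
   Context: A graph $(X,\lambda)$ is an at most countable set $X$ (vertices) with a weight function $\lambda\colon X\times X\to\mathbb{R}$ such that $\lambda\ge 0$, $\{y\colon\lambda(x,y)\ne 0\}$ is finite for every $x\in X$, and $\sum_{y\in X}\lambda(x,y)=1$ for every $x\in X$. There is a directed edge from $x$ to $y$ exactly when $\lambda(x,y)>0$; $\lambda$ need not be symmetric. The Kiselman boundary is $\partial X=\{x\in X\colon \lambda(x,x)=1\}$ and the interior is $X^\circ=X\setminus\partial X$. For $a\in X$ let $N_0(a)=\{a\}$, $N_{k+1}(a)=\{y\colon \lambda(x,y)>0\text{ for some }x\in N_k(a)\}$, and $C(a)=\bigcup_{k\ge0}N_k(a)$. The graph $X$ is connected if $C(a)=X$ for all $a\in X^\circ$. The graph is quasi-reversible if $\lambda(x,y)>0$ implies that either $\lambda(y,x)>0$ or $\lambda(y,y)=1$. A function $f\colon X\to\mathbb{R}$ is subharmonic on $X$, written $f\in S(X)$, if $f(x)\le\sum_{\zeta\in X}\lambda(x,\zeta)f(\zeta)$ for every $x\in X$. Ends: a ray is a one-way infinite sequence $\pi=x_0x_1x_2\ldots$ of pairwise distinct vertices with $\lambda(x_i,x_{i+1})>0$ for all $i\ge0$. For a finite $A\subset X$, the graph $X\setminus A$ breaks into connected components (as a graph, ignoring edge directions);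 $\pi$ is said to end in the component of $X\setminus A$ that contains infinitely many of the points of $\pi$. Two rays are equivalent if they end in the same component of $X\setminus A$ for every finite $A\subset X$. An end is an equivalence class of rays. Let $\partial_{end}X$ be the set of ends, $\hat X=X\cup\partial_{end}X$, and $\partial\hat X=\partial X\cup\partial_{end}X$. $S(\hat X)$ is the set of functions $f\colon\hat X\to\mathbb{R}$ such that $f|_X\in S(X)$ and $\limsup_{i\to\infty}f(x_i)\le f(\omega)$ for every end $\omega\in\partial_{end}X$ and every ray $\pi=x_0x_1x_2\ldots$ in $\omega$. The class of harmonic functions on $\hat X$ is $H(\hat X)=S(\hat X)\cap(-S(\hat X))$, where $-S(\hat X)=\{-f\colon f\in S(\hat X)\}$. A solution to the Dirichlet problem on $\hat X$ with boundary data $f\colon\partial\hat X\to\mathbb{R}$ is a function $h\in H(\hat X)$ with $h|_{\partial\hat X}=f$.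
   Formalization: The formal theorem additionally assumes that the boundary of X̂ (Kiselman boundary together with the ends) is nonempty; otherwise, e.g. for two vertices joined by weight-1 edges both ways, every constant is a solution and uniqueness fails. *)

theory Defs
  imports Complex_Main "HOL-Library.Countable_Set" "HOL-Library.Extended_Real"
begin

definition weighted_graph :: "'a set \<Rightarrow> ('a \<Rightarrow> 'a \<Rightarrow> real) \<Rightarrow> bool" where
  "weighted_graph X w \<longleftrightarrow>
     countable X \<and>
     (\<forall>x\<in>X. \<forall>y\<in>X. 0 \<le> w x y) \<and>
     (\<forall>x\<in>X. finite {y\<in>X. w x y \<noteq> 0}) \<and>
     (\<forall>x\<in>X. (\<Sum>y | y \<in> X \<and> w x y \<noteq> 0. w x y) = 1)"

definition boundary :: "'a set \<Rightarrow> ('a \<Rightarrow> 'a \<Rightarrow> real) \<Rightarrow> 'a set" where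
  "boundary X w = {x\<in>X. w x x = 1}"

definition interior_vertices :: "'a set \<Rightarrow> ('a \<Rightarrow> 'a \<Rightarrow> real) \<Rightarrow> 'a set" where
  "interior_vertices X w = X - boundary X w"

primrec nbhd :: "'a set \<Rightarrow> ('a \<Rightarrow> 'a \<Rightarrow> real) \<Rightarrow> nat \<Rightarrow> 'a \<Rightarrow> 'a set" where
  "nbhd X w 0 a = {a}"
| "nbhd X w (Suc k) a = {y\<in>X. \<exists>x\<in>nbhd X w k a. w x y > 0}"

definition reach :: "'a set \<Rightarrow> ('a \<Rightarrow> 'a \<Rightarrow> real) \<Rightarrow> 'a \<Rightarrow> 'a set" where
  "reach X w a = (\<Union>k. nbhd X w k a)"

definition connected_graph :: "'a set \<Rightarrow> ('a \<Rightarrow> 'a \<Rightarrow> real) \<Rightarrow> bool" where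
  "connected_graph X w \<longleftrightarrow> (\<forall>a\<in>interior_vertices X w. reach X w a = X)"

definition quasi_reversible :: "'a set \<Rightarrow> ('a \<Rightarrow> 'a \<Rightarrow> real) \<Rightarrow> bool" where
  "quasi_reversible X w \<longleftrightarrow>
     (\<forall>x\<in>X. \<forall>y\<in>X. w x y > 0 \<longrightarrow> w y x > 0 \<or> w y y = 1)"

(* The sum is restricted to the finite support of w x: over an infinite X,
   sum would be 0 by convention. *)
definition subharmonic :: "'a set \<Rightarrow> ('a \<Rightarrow> 'a \<Rightarrow> real) \<Rightarrow> ('a \<Rightarrow> real) set" where
  "subharmonic X w =
     {f. \<forall>x\<in>X. f x \<le> (\<Sum>z | z \<in> X \<and> w x z \<noteq> 0. w x z * f z)}"

definition rays :: "'a set \<Rightarrow> ('a \<Rightarrow> 'a \<Rightarrow> real) \<Rightarrow> (nat \<Rightarrow> 'a) set" where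
  "rays X w = {p. range p \<subseteq> X \<and> inj p \<and> (\<forall>i. w (p i) (p (Suc i)) > 0)}"

definition undirected_edges :: "('a \<Rightarrow> 'a \<Rightarrow> real) \<Rightarrow> 'a set \<Rightarrow> ('a \<times> 'a) set" where
  "undirected_edges w B = {(x, y). x \<in> B \<and> y \<in> B \<and> (w x y > 0 \<or> w y x > 0)}"

definition graph_components :: "('a \<Rightarrow> 'a \<Rightarrow> real) \<Rightarrow> 'a set \<Rightarrow> 'a set set" where
  "graph_components w B = {(undirected_edges w B)\<^sup>* `` {x} | x. x \<in> B}"

definition ends_in ::
  "'a set \<Rightarrow> ('a \<Rightarrow> 'a \<Rightarrow> real) \<Rightarrow> 'a set \<Rightarrow> (nat \<Rightarrow> 'a) \<Rightarrow> 'a set \<Rightarrow> bool" where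
  "ends_in X w A p K \<longleftrightarrow> K \<in> graph_components w (X - A) \<and> infinite (range p \<inter> K)"

definition ray_equiv ::
  "'a set \<Rightarrow> ('a \<Rightarrow> 'a \<Rightarrow> real) \<Rightarrow> ((nat \<Rightarrow> 'a) \<times> (nat \<Rightarrow> 'a)) set" where
  "ray_equiv X w = {(p, q). p \<in> rays X w \<and> q \<in> rays X w \<and>
     (\<forall>A. finite A \<and> A \<subseteq> X \<longrightarrow> (\<exists>K. ends_in X w A p K \<and> ends_in X w A q K))}"

definition graph_ends :: "'a set \<Rightarrow> ('a \<Rightarrow> 'a \<Rightarrow> real) \<Rightarrow> (nat \<Rightarrow> 'a) set set" where
  "graph_ends X w = rays X w // ray_equiv X w"

type_synonym 'a hat = "'a + (nat \<Rightarrow> 'a) set"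

definition hat :: "'a set \<Rightarrow> ('a \<Rightarrow> 'a \<Rightarrow> real) \<Rightarrow> 'a hat set" where
  "hat X w = X <+> graph_ends X w"

definition boundary_hat :: "'a set \<Rightarrow> ('a \<Rightarrow> 'a \<Rightarrow> real) \<Rightarrow> 'a hat set" where
  "boundary_hat X w = boundary X w <+> graph_ends X w"

(* Functions on hat X w are total HOL functions whose values outside hat X w are
   irrelevant. The limsup is taken in ereal because the values along a ray may be
   unbounded. *)
definition subharmonic_hat :: "'a set \<Rightarrow> ('a \<Rightarrow> 'a \<Rightarrow> real) \<Rightarrow> ('a hat \<Rightarrow> real) set" where
  "subharmonic_hat X w =
     {f. (\<lambda>x. f (Inl x)) \<in> subharmonic X w \<and>
         (\<forall>e\<in>graph_ends X w. \<forall>p\<in>e. limsup (\<lambda>i. ereal (f (Inl (p i)))) \<le> ereal (f (Inr e)))}"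

definition harmonic_hat :: "'a set \<Rightarrow> ('a \<Rightarrow> 'a \<Rightarrow> real) \<Rightarrow> ('a hat \<Rightarrow> real) set" where
  "harmonic_hat X w = subharmonic_hat X w \<inter> {\<lambda>v. - f v | f. f \<in> subharmonic_hat X w}"

definition dirichlet_solution ::
  "'a set \<Rightarrow> ('a \<Rightarrow> 'a \<Rightarrow> real) \<Rightarrow> ('a hat \<Rightarrow> real) \<Rightarrow> ('a hat \<Rightarrow> real) \<Rightarrow> bool" where
  "dirichlet_solution X w f h \<longleftrightarrow>
     h \<in> harmonic_hat X w \<and> (\<forall>v\<in>boundary_hat X w. h v = f v)"

end

(* Maximum principle. If u is subharmonic and positive somewhere, then either u is constant, or
   from every vertex with u > 0 one can walk along edges on which u does not decrease, first
   inside the level set towards a vertex having a strictly larger out-neighbour, then up to that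
   neighbour. Always taking a shortest way inside the level set, one never revisits a vertex, so
   the walk is a ray on which u stays bounded away from 0. Applied to the difference of two
   solutions, this contradicts the vanishing of the boundary data. *)

theory Submission
  imports Defs
begin

text \<open>The weights at \<open>x\<close> sum to 1, so an average of values that are all at most
  \<open>u x\<close> drops strictly below \<open>u x\<close> as soon as one value of positive weight
  does.\<close>

lemma subharmonic_neighbour:
  assumes "weighted_graph X w" "u \<in> subharmonic X w" "x \<in> X"
    and le: "\<And>y. y \<in> X \<Longrightarrow> w x y > 0 \<Longrightarrow> u y \<le> u x"
    and y: "y \<in> X" "w x y > 0"
  shows "u y = u x"
proof (rule ccontr)
  assume "u y \<noteq> u x"
  let ?S = "{z. z \<in> X \<and> w x z \<noteq> 0}"
  have fin: "finite ?S" and sum1: "(\<Sum>z\<in>?S. w x z) = 1" and nn: "\<And>z. z \<in> X \<Longrightarrow> 0 \<le> w x z"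
    using assms(1,3) by (auto simp: weighted_graph_def)
  have "(\<Sum>z\<in>?S. w x z * u z) < (\<Sum>z\<in>?S. w x z * u x)"
  proof (rule sum_strict_mono_ex1[OF fin])
    show "\<forall>z\<in>?S. w x z * u z \<le> w x z * u x"
      using le nn by (auto intro!: mult_left_mono simp: less_le)
    show "\<exists>z\<in>?S. w x z * u z < w x z * u x"
      using y le[OF y] \<open>u y \<noteq> u x\<close> by (intro bexI[of _ y]) auto
  qed
  also have "\<dots> = u x"
    by (simp add: sum_distrib_right[symmetric] sum1)
  finally show False
    using assms(2,3) by (fastforce simp: subharmonic_def)
qed

lemma subharmonic_add:
  assumes "f \<in> subharmonic X w" "g \<in> subharmonic X w"
  shows "(\<lambda>x. f x + g x) \<in> subharmonic X w"
  using assms by (auto simp: subharmonic_def distrib_left sum.distrib intro: add_mono)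

text \<open>Ends are kept out of this lemma: \<open>ray\<close> only says that no positive constant
  bounds \<open>u\<close> from below along a ray. The assumption \<open>ne\<close> excludes positive
  constant functions.\<close>

lemma subharmonic_maximum_principle:
  assumes graph: "weighted_graph X w" and conn: "connected_graph X w"
    and sub: "u \<in> subharmonic X w"
    and bd: "\<And>x. x \<in> boundary X w \<Longrightarrow> u x \<le> 0"
    and ray: "\<And>p e. p \<in> rays X w \<Longrightarrow> 0 < e \<Longrightarrow> \<exists>i. u (p i) < e"
    and ne: "boundary X w \<noteq> {} \<or> rays X w \<noteq> {}"
    and "x \<in> X"
  shows "u x \<le> 0"
proof (rule ccontr)
  assume "\<not> u x \<le> 0"
  define L where "L = {(y, z). y \<in> X \<and> z \<in> X \<and> w y z > 0 \<and> u z = u y}"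
  define up where "up y \<longleftrightarrow> y \<in> X \<and> (\<exists>z\<in>X. w y z > 0 \<and> u y < u z)" for y
  \<comment> \<open>The \<open>L\<close>-distance from \<open>y\<close> to a nearest vertex
    satisfying \<open>up\<close>; the \<open>LEAST\<close> is meaningful only where such a vertex
    can be reached, which \<open>ex_up\<close> ensures when \<open>u y > 0\<close>.\<close>
  define d where "d y = (LEAST n. \<exists>z. (y, z) \<in> L ^^ n \<and> up z)" for y
  have L_star: "z \<in> X \<and> u z = u y" if "(y, z) \<in> L\<^sup>*" "y \<in> X" for y z
    using that by (induction rule: rtrancl_induct) (auto simp: L_def)
  have ex_up: "\<exists>n z. (y, z) \<in> L ^^ n \<and> up z" if y: "y \<in> X" "u y > 0" for y
  proof (rule ccontr)
    assume "\<not> ?thesis"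
    then have no: "\<not> up z" if "(y, z) \<in> L\<^sup>*" for z
      using that by (auto simp: rtrancl_power)
    \<comment> \<open>Without an \<open>up\<close> vertex in the \<open>L\<close>-closure of
      \<open>y\<close>, each vertex there is a local maximum, so
      \<open>subharmonic_neighbour\<close> makes every edge leaving it an
      \<open>L\<close>-edge.\<close>
    have "nbhd X w k y \<subseteq> L\<^sup>* `` {y}" for k
    proof (induction k)
      case (Suc k)
      show ?case
      proof
        fix z assume "z \<in> nbhd X w (Suc k) y"
        then obtain v where v: "z \<in> X" "w v z > 0" "(y, v) \<in> L\<^sup>*"
          using Suc by auto
        then have "v \<in> X"
          using L_star y by blast
        have "u z' \<le> u v" if "z' \<in> X" "w v z' > 0" for z'
          using that no[OF v(3)] \<open>v \<in> X\<close> unfolding up_def by (meson not_le)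
        from subharmonic_neighbour[OF graph sub \<open>v \<in> X\<close> this v(1,2)] have "u z = u v"
          by blast
        then have "(v, z) \<in> L"
          using v \<open>v \<in> X\<close> by (simp add: L_def)
        with v(3) show "z \<in> L\<^sup>* `` {y}"
          by auto
      qed
    qed auto
    then have "reach X w y \<subseteq> L\<^sup>* `` {y}"
      by (auto simp: reach_def)
    \<comment> \<open>Since \<open>u y > 0\<close>, the bound \<open>bd\<close> forces
      \<open>y\<close> to be interior, so connectedness applies to it.\<close>
    moreover have "reach X w y = X"
      using conn y bd[of y] by (fastforce simp: connected_graph_def interior_vertices_def)
    ultimately have const: "u z = u y" if "z \<in> X" for z
      using L_star y that by blast
    have "boundary X w = {}"
      using bd const y(2) unfolding boundary_def
      by (metis (no_types, lifting) all_not_in_conv leD mem_Collect_eq)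
    then obtain p where p: "p \<in> rays X w"
      using ne by blast
    then have "u (p i) = u y" for i
      by (intro const) (auto simp: rays_def)
    with ray[OF p y(2)] show False
      by simp
  qed
  \<comment> \<open>A strict lexicographic order: \<open>u\<close> grows, or \<open>u\<close> stays
    equal and \<open>d\<close> shrinks. Being transitive and irreflexive, it forbids a walk along it
    to return to a vertex.\<close>
  define R where "R y z \<longleftrightarrow> u y < u z \<or> (u y = u z \<and> d z < d y)" for y z
  have step: "\<exists>z. z \<in> X \<and> w y z > 0 \<and> R y z" if y: "y \<in> X" "u y > 0" for y
  proof -
    have "\<exists>z. (y, z) \<in> L ^^ d y \<and> up z"
      unfolding d_def by (rule LeastI_ex[OF ex_up[OF y]])
    then obtain z where z: "(y, z) \<in> L ^^ d y" "up z"
      by blast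
    show ?thesis
    \<comment> \<open>At distance 0 the vertex \<open>y\<close> is itself \<open>up\<close>;
      otherwise the first edge of a shortest \<open>L\<close>-path lowers \<open>d\<close>.\<close>
    proof (cases "d y")
      case 0
      with z show ?thesis by (auto simp: up_def R_def)
    next
      case (Suc m)
      with z obtain v where v: "(y, v) \<in> L" "(v, z) \<in> L ^^ m"
        by (metis relpow_Suc_D2)
      have "d v \<le> m"
        unfolding d_def using v z by (intro Least_le) blast
      with v Suc show ?thesis
        by (intro exI[of _ v]) (auto simp: L_def R_def)
    qed
  qed
  \<comment> \<open>The invariant \<open>u x \<le> u (p i)\<close> keeps the walk where
    \<open>step\<close> applies, and finally contradicts \<open>ray\<close> with the constant
    \<open>u x\<close>.\<close>
  have "\<exists>p. \<forall>i. (p i \<in> X \<and> u x \<le> u (p i)) \<and> (w (p i) (p (Suc i)) > 0 \<and> R (p i) (p (Suc i)))"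
  proof (rule dependent_nat_choice)
    show "\<exists>y. y \<in> X \<and> u x \<le> u y"
      using \<open>x \<in> X\<close> by blast
    fix y and n :: nat
    assume y: "y \<in> X \<and> u x \<le> u y"
    then obtain z where "z \<in> X" "w y z > 0" "R y z"
      using step[of y] \<open>\<not> u x \<le> 0\<close> by auto
    with y show "\<exists>z. (z \<in> X \<and> u x \<le> u z) \<and> (w y z > 0 \<and> R y z)"
      by (intro exI[of _ z]) (auto simp: R_def)
  qed
  then obtain p where p: "\<And>i. p i \<in> X" "\<And>i. u x \<le> u (p i)" "\<And>i. w (p i) (p (Suc i)) > 0"
    "\<And>i. R (p i) (p (Suc i))"
    by blast
  have R_less: "R (p i) (p j)" if "i < j" for i j
    using that
  proof (induction rule: less_Suc_induct)
    case (2 i j k)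
    then show ?case by (auto simp: R_def)
  qed (rule p(4))
  have "inj p"
  proof (rule injI)
    fix i j assume "p i = p j"
    then show "i = j"
      using R_less[of i j] R_less[of j i] by (cases i j rule: linorder_cases) (auto simp: R_def)
  qed
  with p have "p \<in> rays X w"
    by (auto simp: rays_def)
  from ray[OF this, of "u x"] p(2) \<open>\<not> u x \<le> 0\<close> show False
    by (meson leD not_le)
qed

text \<open>An injective sequence meets a finite set only finitely often, so a tail of the ray
  avoids \<open>A\<close>; consecutive vertices of the tail are adjacent, which puts it into one
  component.\<close>

lemma ray_ends_in_component:
  assumes p: "p \<in> rays X w" and "finite A"
  shows "\<exists>K. ends_in X w A p K"
proof -
  have inj: "inj p" and pX: "\<And>i. p i \<in> X" and edge: "\<And>i. w (p i) (p (Suc i)) > 0"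
    using p by (auto simp: rays_def)
  have "finite (p -` A)"
    using \<open>finite A\<close> inj by (rule finite_vimageI)
  then obtain n where "\<forall>i\<in>p -` A. i < n"
    using finite_nat_set_iff_bounded by blast
  then have n: "p i \<notin> A" if "n \<le> i" for i
    using that by (meson leD vimageI)
  let ?E = "undirected_edges w (X - A)"
  have conn: "(p n, p i) \<in> ?E\<^sup>*" if "n \<le> i" for i
    using that
  proof (induction i rule: dec_induct)
    case (step i)
    then have "(p i, p (Suc i)) \<in> ?E"
      using n pX edge by (auto simp: undirected_edges_def)
    with step show ?case by auto
  qed auto
  have "p ` {n..} \<subseteq> range p \<inter> ?E\<^sup>* `` {p n}"
    using conn by auto
  moreover have "infinite (p ` {n..})"
    using inj infinite_Ici by (metis finite_imageD inj_on_subset subset_UNIV)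
  ultimately have "infinite (range p \<inter> ?E\<^sup>* `` {p n})"
    using infinite_super by blast
  moreover have "?E\<^sup>* `` {p n} \<in> graph_components w (X - A)"
    using n pX by (auto simp: graph_components_def)
  ultimately show ?thesis
    by (auto simp: ends_in_def)
qed

text \<open>That \<open>p\<close> lies in its own class is reflexivity of \<open>ray_equiv\<close>,
  and this amounts to \<open>p\<close> ending in some component for each finite
  \<open>A\<close>.\<close>

lemma ray_in_graph_end:
  assumes "p \<in> rays X w"
  obtains e where "e \<in> graph_ends X w" "p \<in> e"
proof
  show "ray_equiv X w `` {p} \<in> graph_ends X w"
    using assms by (auto simp: graph_ends_def intro: quotientI)
  show "p \<in> ray_equiv X w `` {p}"
    using assms ray_ends_in_component[OF assms] by (auto simp: ray_equiv_def)
qed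

lemma subharmonic_hat_eventually_less:
  assumes "f \<in> subharmonic_hat X w" "e \<in> graph_ends X w" "p \<in> e" "f (Inr e) < c"
  shows "\<forall>\<^sub>F i in sequentially. f (Inl (p i)) < c"
proof -
  have "limsup (\<lambda>i. ereal (f (Inl (p i)))) \<le> ereal (f (Inr e))"
    using assms(1-3) by (auto simp: subharmonic_hat_def)
  also have "\<dots> < ereal c"
    using assms(4) by simp
  finally show ?thesis
    using Limsup_lessD by fastforce
qed

text \<open>A sum rather than a difference, because both summands have to be subharmonic: the
  intended pair is one solution and the negative of another.\<close>

lemma subharmonic_hat_maximum_principle:
  assumes graph: "weighted_graph X w" and conn: "connected_graph X w"
    and ne: "boundary_hat X w \<noteq> {}"
    and f: "f \<in> subharmonic_hat X w" and g: "g \<in> subharmonic_hat X w"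
    and bd: "\<And>v. v \<in> boundary_hat X w \<Longrightarrow> f v + g v \<le> 0"
    and "x \<in> X"
  shows "f (Inl x) + g (Inl x) \<le> 0"
proof (rule subharmonic_maximum_principle[OF graph conn _ _ _ _ \<open>x \<in> X\<close>])
  show "(\<lambda>x. f (Inl x) + g (Inl x)) \<in> subharmonic X w"
    using f g by (auto simp: subharmonic_hat_def intro: subharmonic_add)
  show "f (Inl y) + g (Inl y) \<le> 0" if "y \<in> boundary X w" for y
    using that bd[of "Inl y"] by (auto simp: boundary_hat_def)
  show "\<exists>i. f (Inl (p i)) + g (Inl (p i)) < c" if p: "p \<in> rays X w" and "0 < c" for p c
  proof -
    obtain e where e: "e \<in> graph_ends X w" "p \<in> e"
      using p by (rule ray_in_graph_end)
    \<comment> \<open>The limsup bounds hold for \<open>f\<close> and \<open>g\<close> separately,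
      so each gets half of the slack \<open>c\<close>; the boundary values at \<open>e\<close> add
      up to at most 0.\<close>
    have "\<forall>\<^sub>F i in sequentially.
        f (Inl (p i)) < f (Inr e) + c / 2 \<and> g (Inl (p i)) < g (Inr e) + c / 2"
      using \<open>0 < c\<close> by (intro eventually_conj subharmonic_hat_eventually_less[OF f e]
          subharmonic_hat_eventually_less[OF g e]) auto
    then obtain i where "f (Inl (p i)) < f (Inr e) + c / 2" "g (Inl (p i)) < g (Inr e) + c / 2"
      by (auto simp: eventually_sequentially)
    moreover have "f (Inr e) + g (Inr e) \<le> 0"
      using bd[of "Inr e"] e by (auto simp: boundary_hat_def)
    ultimately show ?thesis
      by (intro exI[of _ i]) linarith
  qed
  show "boundary X w \<noteq> {} \<or> rays X w \<noteq> {}"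
    using ne by (auto simp: boundary_hat_def graph_ends_def quotient_def)
qed

theorem theorem3:
  fixes X :: "'a set" and w :: "'a \<Rightarrow> 'a \<Rightarrow> real"
  assumes "weighted_graph X w"
    and "connected_graph X w"
    and "quasi_reversible X w"
    and "boundary_hat X w \<noteq> {}"
  shows "\<forall>f h1 h2. dirichlet_solution X w f h1 \<and> dirichlet_solution X w f h2 \<longrightarrow>
           (\<forall>v\<in>hat X w. h1 v = h2 v)"
proof (intro allI impI ballI)
  fix f h1 h2 v
  assume h: "dirichlet_solution X w f h1 \<and> dirichlet_solution X w f h2" and v: "v \<in> hat X w"
  \<comment> \<open>Stated for an arbitrary ordered pair of solutions, so that exchanging them gives
    equality by antisymmetry.\<close>
  have le: "g1 (Inl x) \<le> g2 (Inl x)"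
    if g: "dirichlet_solution X w f g1" "dirichlet_solution X w f g2" and "x \<in> X" for g1 g2 x
  proof -
    have "g1 \<in> subharmonic_hat X w" "(\<lambda>v. - g2 v) \<in> subharmonic_hat X w"
      using g by (auto simp: dirichlet_solution_def harmonic_hat_def)
    from subharmonic_hat_maximum_principle[OF assms(1,2,4) this _ \<open>x \<in> X\<close>] g show ?thesis
      by (auto simp: dirichlet_solution_def)
  qed
  show "h1 v = h2 v"
  proof (cases v)
    case (Inl x)
    with v have "x \<in> X"
      by (auto simp: hat_def)
    then show ?thesis
      using le[of h1 h2] le[of h2 h1] h Inl by (auto intro: antisym)
  next
    case (Inr e)
    with v have "v \<in> boundary_hat X w"
      by (auto simp: hat_def boundary_hat_def)
    then show ?thesis
      using h by (simp add: dirichlet_solution_def)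
  qed
qed

end
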